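(* Let $\varepsilon>0$, $\eta\in\mathbb R$, $\Delta t>0$, and let $(U^{(n)})_{n\ge0}\subset L_{\mathrm d}^2$ be the numerical solution, from initial value $U^{(0)}$, of the scheme $$\frac{U^{(n+1)}-U^{(n)}}{\Delta t}=\begin{cases}-\left[(U^{(n)})^3+\left\{(1-\eta)U^{(n+1)}+\varepsilon\Delta_{\mathrm d}^2U^{(n+1)}\right\}+2\Delta_{\mathrm d}U^{(n)}\right]&(\eta<1),\\-\left[(U^{(n)})^3+\varepsilon\Delta_{\mathrm d}^2U^{(n+1)}-\left\{(\eta-1)U^{(n)}-2\Delta_{\mathrm d}U^{(n)}\right\}\right]&(\eta\ge1),\end{cases}$$ with the discrete Neumann boundary conditions. For an arbitrary $\zeta>\frac1\varepsilon+\eta-1$, let $$C_{\varepsilon,\eta,\zeta}=\frac{\varepsilon+1-\eta+\zeta-\sqrt{(\varepsilon-1+\eta-\zeta)^2+4}}{6}$$ and $$M=\max\left\{\sqrt{\max\{0,\zeta\}},\ \sqrt{\frac{C^2}{C_{\varepsilon,\eta,\zeta}}\left(H(U^{(0)})+\frac{\zeta^2}{4}\ell_x\ell_y\ell_z\right)}\right\}.$$ If either $3M^2\le|1-\eta|$, or $3M^2>|1-\eta|$ and $\Delta t\le\frac{2}{3M^2-|1-\eta|}$, then $H(U^{(n)})$ is non-increasing in $n$, and for every $n$ $$\|U^{(n)}\|_{L_{\mathrm d}^\infty}\le\sqrt{\frac{C^2}{C_{\varepsilon,\eta,\zeta}}\left(H(U^{(0)})+\frac{\zeta^2}{4}\e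ll_x\ell_y\ell_z\right)}.$$
   Context: Fix lengths $\ell_x,\ell_y,\ell_z>0$, positive integers $N_x,N_y,N_z$, and mesh sizes $\Delta x=\ell_x/N_x$, $\Delta y=\ell_y/N_y$, $\Delta z=\ell_z/N_z$. $L_{\mathrm d}^2$ is the real vector space of arrays $U=(U_{i,j,k})$ with $0\le i\le N_x$, $0\le j\le N_y$, $0\le k\le N_z$. Write $\sum''_{i=0}^{N}a_i=\frac{a_0}{2}+a_1+\dots+a_{N-1}+\frac{a_N}{2}$ and $\sum''_{i,j,k}=\sum''_{i=0}^{N_x}\sum''_{j=0}^{N_y}\sum''_{k=0}^{N_z}$. Norms: $\|U\|_{L_{\mathrm d}^2}=\left(\sum''_{i,j,k}U_{i,j,k}^2\Delta x\Delta y\Delta z\right)^{1/2}$ and $\|U\|_{L_{\mathrm d}^\infty}=\max_{i,j,k}|U_{i,j,k}|$ over the grid. Difference operators: $\delta_i^+f_{i,j,k}=\frac{f_{i+1,j,k}-f_{i,j,k}}{\Delta x}$, $\delta_i^-f_{i,j,k}=\frac{f_{i,j,k}-f_{i-1,j,k}}{\Delta x}$, $\delta_i^{\langle1\rangle}f_{i,j,k}=\frac{f_{i+1,j,k}-f_{i-1,j,k}}{2\Delta x}$, and analogously in $j$ (with $\Delta y$) and $k$ (with $\Delta z$). $\nabla_{\mathrm d}^{\pm}=(\delta_i^{\pm},\delta_j^{\pm},\delta_k^{\pm})$, $\Delta_{\mathrm d}=\nabla_{\mathrm d}^+\cdot\nabla_{\mathrm d}^-=\delta_i^+\delta_i^-+\delta_j^+\delta_j^-+\delta_k^+\delta_k^-$,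 $\Delta_{\mathrm d}^2=\Delta_{\mathrm d}\Delta_{\mathrm d}$. Seminorm: $\|\mathrm DU\|_{L_{\mathrm d}^2}=\left(\sum''_{i,j,k}\frac{|\nabla_{\mathrm d}^+U_{i,j,k}|^2+|\nabla_{\mathrm d}^-U_{i,j,k}|^2}{2}\Delta x\Delta y\Delta z\right)^{1/2}$. The cube $U^3$ is entrywise. Discrete Neumann boundary conditions: $\delta_i^{\langle1\rangle}U_{i,j,k}=\delta_i^{\langle1\rangle}\Delta_{\mathrm d}U_{i,j,k}=0$ at $i=0,N_x$; $\delta_j^{\langle1\rangle}U_{i,j,k}=\delta_j^{\langle1\rangle}\Delta_{\mathrm d}U_{i,j,k}=0$ at $j=0,N_y$; $\delta_k^{\langle1\rangle}U_{i,j,k}=\delta_k^{\langle1\rangle}\Delta_{\mathrm d}U_{i,j,k}=0$ at $k=0,N_z$. These determine the values of $U$ at exterior (ghost) indices: they amount to even reflection in each index, $U_{-p,j,k}=U_{p,j,k}$, $U_{N_x+p,j,k}=U_{N_x-p,j,k}$ for $p=1,2$, and similarly in $j,k$. Elements of $L_{\mathrm d}^2$ are extended in this way whenever difference operators are applied. Discrete energy: $$H(U)=\sum''_{i,j,k}\left(\frac14U_{i,j,k}^4+\frac{1-\eta}{2}U_{i,j,k}^2-\frac{|\nabla_{\mathrm d}^+U_{i,j,k}|^2+|\nabla_{\mathrm d}^-U_{i,j,k}|^2}{2}+\frac\varepsilon2(\Delta_{\mathrm d}U_{i,j,k})^2\right)\Delta x\Delta y\Delta z.$$ $C>0$ is a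 discrete Sobolev constant, i.e. a constant (independent of the mesh) such that $\|U\|_{L_{\mathrm d}^\infty}\le C\sqrt{\|U\|_{L_{\mathrm d}^2}^2+\|\mathrm DU\|_{L_{\mathrm d}^2}^2+\|\Delta_{\mathrm d}U\|_{L_{\mathrm d}^2}^2}$ for all grid functions $U$ satisfying the discrete Neumann boundary conditions; such a constant exists and is fixed. *)

theory Defs
  imports Complex_Main
begin

record mesh =
  lenx :: real
  leny :: real
  lenz :: real
  nx :: nat
  ny :: nat
  nz :: nat

definition valid_mesh :: "mesh \<Rightarrow> bool" where
  "valid_mesh G \<longleftrightarrow> lenx G > 0 \<and> leny G > 0 \<and> lenz G > 0 \<and> nx G > 0 \<and> ny G > 0 \<and> nz G > 0"

definition dx :: "mesh \<Rightarrow> real" where "dx G = lenx G / real (nx G)"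
definition dy :: "mesh \<Rightarrow> real" where "dy G = leny G / real (ny G)"
definition dz :: "mesh \<Rightarrow> real" where "dz G = lenz G / real (nz G)"

(* Elements of L^2_d are arrays; only the entries with i <= nx, j <= ny, k <= nz are ever used.
   Difference operators act on lattice functions, i.e. arrays extended to exterior indices. *)
type_synonym array = "nat \<Rightarrow> nat \<Rightarrow> nat \<Rightarrow> real"
type_synonym lattice = "int \<Rightarrow> int \<Rightarrow> int \<Rightarrow> real"

subsection \<open>Extension by even reflection\<close>

(* The even reflection about 0 and N, as the map of period 2N folding the integers onto {0..N}.
   The periodic form also covers N = 1, where the ghost index -2 has to be reflected twice. *)
definition reflect :: "nat \<Rightarrow> int \<Rightarrow> nat" where
  "reflect N i = (let m = i mod (2 * int N) in nat (if m \<le> int N then m else 2 * int N - m))"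

definition ext :: "mesh \<Rightarrow> array \<Rightarrow> lattice" where
  "ext G U = (\<lambda>i j k. U (reflect (nx G) i) (reflect (ny G) j) (reflect (nz G) k))"

subsection \<open>Difference operators\<close>

definition Dxp :: "mesh \<Rightarrow> lattice \<Rightarrow> lattice" where
  "Dxp G f = (\<lambda>i j k. (f (i + 1) j k - f i j k) / dx G)"
definition Dyp :: "mesh \<Rightarrow> lattice \<Rightarrow> lattice" where
  "Dyp G f = (\<lambda>i j k. (f i (j + 1) k - f i j k) / dy G)"
definition Dzp :: "mesh \<Rightarrow> lattice \<Rightarrow> lattice" where
  "Dzp G f = (\<lambda>i j k. (f i j (k + 1) - f i j k) / dz G)"

definition Dxm :: "mesh \<Rightarrow> lattice \<Rightarrow> lattice" where
  "Dxm G f = (\<lambda>i j k. (f i j k - f (i - 1) j k) / dx G)"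
definition Dym :: "mesh \<Rightarrow> lattice \<Rightarrow> lattice" where
  "Dym G f = (\<lambda>i j k. (f i j k - f i (j - 1) k) / dy G)"
definition Dzm :: "mesh \<Rightarrow> lattice \<Rightarrow> lattice" where
  "Dzm G f = (\<lambda>i j k. (f i j k - f i j (k - 1)) / dz G)"

definition Dxc :: "mesh \<Rightarrow> lattice \<Rightarrow> lattice" where
  "Dxc G f = (\<lambda>i j k. (f (i + 1) j k - f (i - 1) j k) / (2 * dx G))"
definition Dyc :: "mesh \<Rightarrow> lattice \<Rightarrow> lattice" where
  "Dyc G f = (\<lambda>i j k. (f i (j + 1) k - f i (j - 1) k) / (2 * dy G))"
definition Dzc :: "mesh \<Rightarrow> lattice \<Rightarrow> lattice" where
  "Dzc G f = (\<lambda>i j k. (f i j (k + 1) - f i j (k - 1)) / (2 * dz G))"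

definition lap :: "mesh \<Rightarrow> lattice \<Rightarrow> lattice" where
  "lap G f = (\<lambda>i j k. Dxp G (Dxm G f) i j k + Dyp G (Dym G f) i j k + Dzp G (Dzm G f) i j k)"

(* (|grad^+ f|^2 + |grad^- f|^2) / 2 *)
definition grad_sq :: "mesh \<Rightarrow> lattice \<Rightarrow> lattice" where
  "grad_sq G f = (\<lambda>i j k.
     (((Dxp G f i j k)\<^sup>2 + (Dyp G f i j k)\<^sup>2 + (Dzp G f i j k)\<^sup>2)
    + ((Dxm G f i j k)\<^sup>2 + (Dym G f i j k)\<^sup>2 + (Dzm G f i j k)\<^sup>2)) / 2)"

subsection \<open>The discrete Neumann boundary conditions\<close>

definition neumann_bc :: "mesh \<Rightarrow> lattice \<Rightarrow> bool" where
  "neumann_bc G f \<longleftrightarrow>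
     (\<forall>j k. \<forall>i \<in> {0, int (nx G)}. Dxc G f i j k = 0 \<and> Dxc G (lap G f) i j k = 0) \<and>
     (\<forall>i k. \<forall>j \<in> {0, int (ny G)}. Dyc G f i j k = 0 \<and> Dyc G (lap G f) i j k = 0) \<and>
     (\<forall>i j. \<forall>k \<in> {0, int (nz G)}. Dzc G f i j k = 0 \<and> Dzc G (lap G f) i j k = 0)"

lemma reflect_int [simp]: "i \<le> N \<Longrightarrow> reflect N (int i) = i"
  by (cases "N = 0") (auto simp: reflect_def Let_def)

lemma reflect_uminus: "reflect N (- i) = reflect N i"
proof (cases "i mod (2 * int N) = 0")
  case True
  then show ?thesis by (simp add: reflect_def zmod_zminus1_eq_if)
next
  case False
  then show ?thesis by (auto simp: reflect_def Let_def zmod_zminus1_eq_if)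
qed

lemma reflect_shift: "reflect N (i + 2 * int N) = reflect N i"
  by (simp add: reflect_def)

lemma reflect_mirror: "reflect N (int N + p) = reflect N (int N - p)"
  using reflect_uminus[of N "int N - p"] reflect_shift[of N "p - int N"]
  by (simp add: algebra_simps)

lemma ext_grid:
  "i \<le> nx G \<Longrightarrow> j \<le> ny G \<Longrightarrow> k \<le> nz G \<Longrightarrow> ext G U (int i) (int j) (int k) = U i j k"
  by (simp add: ext_def)

lemma neumann_bc_ext: "neumann_bc G (ext G U)"
proof -
  have m: "reflect N (-1) = reflect N 1" "reflect N (-2) = reflect N 2" for N
    using reflect_uminus[of N 1] reflect_uminus[of N 2] by simp_all
  have s: "reflect N (int N - 1) = reflect N (int N + 1)"
          "reflect N (int N - 2) = reflect N (2 + int N)" for N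
    by (simp_all add: reflect_mirror add.commute[of 2])
  show ?thesis
    by (simp add: neumann_bc_def ext_def Dxc_def Dyc_def Dzc_def lap_def
        Dxp_def Dyp_def Dzp_def Dxm_def Dym_def Dzm_def m s diff_divide_distrib
        add.commute[of _ 2])
qed

lemma neumann_bc_imp_reflect:
  assumes "valid_mesh G" "neumann_bc G f" "p \<in> {1, 2}"
  shows "f (- p) j k = f p j k" "f (int (nx G) + p) j k = f (int (nx G) - p) j k"
    "f i (- p) k = f i p k" "f i (int (ny G) + p) k = f i (int (ny G) - p) k"
    "f i j (- p) = f i j p" "f i j (int (nz G) + p) = f i j (int (nz G) - p)"
proof -
  have pos: "dx G \<noteq> 0" "dy G \<noteq> 0" "dz G \<noteq> 0"
    using assms(1) by (auto simp: valid_mesh_def dx_def dy_def dz_def)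
  have x1: "f (a + 1) j k = f (a - 1) j k" and x2: "f (a + 2) j k = f (a - 2) j k"
    if "a \<in> {0, int (nx G)}" for a j k
  proof -
    have *: "f (a + 1) j k = f (a - 1) j k" for j k
    proof -
      have "Dxc G f a j k = 0" using assms(2) that unfolding neumann_bc_def by blast
      then show ?thesis using pos by (simp add: Dxc_def)
    qed
    show "f (a + 1) j k = f (a - 1) j k" by (rule *)
    have "Dxc G (lap G f) a j k = 0" using assms(2) that unfolding neumann_bc_def by blast
    then show "f (a + 2) j k = f (a - 2) j k"
      using pos by (simp add: Dxc_def lap_def Dxp_def Dyp_def Dzp_def Dxm_def Dym_def Dzm_def *
          diff_divide_distrib add.commute[of _ 2])
  qed
  have y1: "f i (a + 1) k = f i (a - 1) k" and y2: "f i (a + 2) k = f i (a - 2) k"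
    if "a \<in> {0, int (ny G)}" for a i k
  proof -
    have *: "f i (a + 1) k = f i (a - 1) k" for i k
    proof -
      have "Dyc G f i a k = 0" using assms(2) that unfolding neumann_bc_def by blast
      then show ?thesis using pos by (simp add: Dyc_def)
    qed
    show "f i (a + 1) k = f i (a - 1) k" by (rule *)
    have "Dyc G (lap G f) i a k = 0" using assms(2) that unfolding neumann_bc_def by blast
    then show "f i (a + 2) k = f i (a - 2) k"
      using pos by (simp add: Dyc_def lap_def Dxp_def Dyp_def Dzp_def Dxm_def Dym_def Dzm_def *
          diff_divide_distrib add.commute[of _ 2])
  qed
  have z1: "f i j (a + 1) = f i j (a - 1)" and z2: "f i j (a + 2) = f i j (a - 2)"
    if "a \<in> {0, int (nz G)}" for a i j
  proof -
    have *: "f i j (a + 1) = f i j (a - 1)" for i j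
    proof -
      have "Dzc G f i j a = 0" using assms(2) that unfolding neumann_bc_def by blast
      then show ?thesis using pos by (simp add: Dzc_def)
    qed
    show "f i j (a + 1) = f i j (a - 1)" by (rule *)
    have "Dzc G (lap G f) i j a = 0" using assms(2) that unfolding neumann_bc_def by blast
    then show "f i j (a + 2) = f i j (a - 2)"
      using pos by (simp add: Dzc_def lap_def Dxp_def Dyp_def Dzp_def Dxm_def Dym_def Dzm_def *
          diff_divide_distrib add.commute[of _ 2])
  qed
  show "f (- p) j k = f p j k" "f (int (nx G) + p) j k = f (int (nx G) - p) j k"
    "f i (- p) k = f i p k" "f i (int (ny G) + p) k = f i (int (ny G) - p) k"
    "f i j (- p) = f i j p" "f i j (int (nz G) + p) = f i j (int (nz G) - p)"
    using assms(3) x1[of 0 j k] x2[of 0 j k] x1[of "int (nx G)" j k] x2[of "int (nx G)" j k]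
      y1[of 0 i k] y2[of 0 i k] y1[of "int (ny G)" i k] y2[of "int (ny G)" i k]
      z1[of 0 i j] z2[of 0 i j] z1[of "int (nz G)" i j] z2[of "int (nz G)" i j]
    by auto
qed

subsection \<open>Norms and energy\<close>

definition trap_sum :: "nat \<Rightarrow> (nat \<Rightarrow> real) \<Rightarrow> real" where
  "trap_sum N a = a 0 / 2 + (\<Sum>i = 1..<N. a i) + a N / 2"

definition grid_sum :: "mesh \<Rightarrow> array \<Rightarrow> real" where
  "grid_sum G a =
     trap_sum (nx G) (\<lambda>i. trap_sum (ny G) (\<lambda>j. trap_sum (nz G) (\<lambda>k. a i j k)))"

definition norm_L2 :: "mesh \<Rightarrow> array \<Rightarrow> real" where
  "norm_L2 G U = sqrt (grid_sum G (\<lambda>i j k. (U i j k)\<^sup>2 * dx G * dy G * dz G))"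

definition norm_Linf :: "mesh \<Rightarrow> array \<Rightarrow> real" where
  "norm_Linf G U = Max {\<bar>U i j k\<bar> |i j k. i \<le> nx G \<and> j \<le> ny G \<and> k \<le> nz G}"

definition seminorm_D :: "mesh \<Rightarrow> array \<Rightarrow> real" where
  "seminorm_D G U =
     sqrt (grid_sum G (\<lambda>i j k. grad_sq G (ext G U) (int i) (int j) (int k) * dx G * dy G * dz G))"

definition lap_array :: "mesh \<Rightarrow> array \<Rightarrow> array" where
  "lap_array G U = (\<lambda>i j k. lap G (ext G U) (int i) (int j) (int k))"

definition bilap_array :: "mesh \<Rightarrow> array \<Rightarrow> array" where
  "bilap_array G U = (\<lambda>i j k. lap G (lap G (ext G U)) (int i) (int j) (int k))"

lemma reflect_invariant:
  assumes "N > 0" and even: "\<And>i. g (- i) = g i" and per: "\<And>i. g (i + 2 * int N) = g i"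
  shows "g (int (reflect N i)) = g i"
proof -
  have nat_per: "g (i + 2 * int N * int n) = g i" for i n
  proof (induction n)
    case (Suc n)
    then show ?case
      using per[of "i + 2 * int N * int n"] by (simp add: algebra_simps)
  qed simp
  have int_per: "g (i + 2 * int N * q) = g i" for i q
  proof (cases "q \<ge> 0")
    case True
    then show ?thesis using nat_per[of i "nat q"] by simp
  next
    case False
    then show ?thesis using nat_per[of "i + 2 * int N * q" "nat (- q)"] by simp
  qed
  define m where "m = i mod (2 * int N)"
  have m: "0 \<le> m" "m < 2 * int N" using assms(1) by (simp_all add: m_def)
  have "g i = g m"
    using int_per[of m "i div (2 * int N)"] by (simp add: m_def)
  moreover have "g (2 * int N - m) = g m"
    using per[of "- m"] even[of m] by simp
  ultimately show ?thesis
    using m by (simp add: reflect_def Let_def flip: m_def)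
qed

(* Extending lap_array again by reflection changes nothing, so bilap_array is lap_array
   applied twice. *)
lemma ext_lap_array:
  assumes "valid_mesh G"
  shows "ext G (lap_array G U) = lap G (ext G U)"
proof (intro HOL.ext)
  fix i j k
  let ?g = "lap G (ext G U)"
  have pos: "nx G > 0" "ny G > 0" "nz G > 0" using assms by (auto simp: valid_mesh_def)
  have r: "reflect N (- i - 1) = reflect N (i + 1)" "reflect N (1 - i) = reflect N (i - 1)"
    "reflect N (i + 2 * int N + 1) = reflect N (i + 1)"
    "reflect N (i + 2 * int N - 1) = reflect N (i - 1)" for N i
  proof -
    have e: "- i - 1 = - (i + 1)" "1 - i = - (i - 1)"
      "i + 2 * int N + 1 = (i + 1) + 2 * int N" "i + 2 * int N - 1 = (i - 1) + 2 * int N"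
      by simp_all
    show "reflect N (- i - 1) = reflect N (i + 1)" "reflect N (1 - i) = reflect N (i - 1)"
      "reflect N (i + 2 * int N + 1) = reflect N (i + 1)"
      "reflect N (i + 2 * int N - 1) = reflect N (i - 1)"
      by (simp_all only: e reflect_uminus reflect_shift)
  qed
  note defs = ext_def lap_def Dxp_def Dyp_def Dzp_def Dxm_def Dym_def Dzm_def
  have x: "?g (int (reflect (nx G) i)) j k = ?g i j k" for i j k
    by (rule reflect_invariant[OF pos(1), of "\<lambda>i. ?g i j k"])
      (simp_all add: defs r reflect_uminus reflect_shift diff_divide_distrib)
  have y: "?g i (int (reflect (ny G) j)) k = ?g i j k" for i j k
    by (rule reflect_invariant[OF pos(2), of "\<lambda>j. ?g i j k"])
      (simp_all add: defs r reflect_uminus reflect_shift diff_divide_distrib)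
  have z: "?g i j (int (reflect (nz G) k)) = ?g i j k" for i j k
    by (rule reflect_invariant[OF pos(3), of "\<lambda>k. ?g i j k"])
      (simp_all add: defs r reflect_uminus reflect_shift diff_divide_distrib)
  show "ext G (lap_array G U) i j k = ?g i j k"
    unfolding ext_def[of G "lap_array G U"] unfolding lap_array_def by (simp only: x y z)
qed

lemma bilap_array_eq: "valid_mesh G \<Longrightarrow> bilap_array G U = lap_array G (lap_array G U)"
  by (simp add: bilap_array_def lap_array_def[of G "lap_array G U"] ext_lap_array)

definition energy :: "mesh \<Rightarrow> real \<Rightarrow> real \<Rightarrow> array \<Rightarrow> real" where
  "energy G \<epsilon> \<eta> U = grid_sum G (\<lambda>i j k.
     (1 / 4 * (U i j k) ^ 4 + (1 - \<eta>) / 2 * (U i j k)\<^sup>2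
      - grad_sq G (ext G U) (int i) (int j) (int k)
      + \<epsilon> / 2 * (lap_array G U i j k)\<^sup>2) * dx G * dy G * dz G)"

(* The constant may depend on the side lengths but not on the numbers of subdivisions. *)
definition discrete_sobolev_const :: "real \<Rightarrow> real \<Rightarrow> real \<Rightarrow> real \<Rightarrow> bool" where
  "discrete_sobolev_const lx ly lz C \<longleftrightarrow> C > 0 \<and>
     (\<forall>G U. valid_mesh G \<and> lenx G = lx \<and> leny G = ly \<and> lenz G = lz \<longrightarrow>
        norm_Linf G U \<le>
          C * sqrt ((norm_L2 G U)\<^sup>2 + (seminorm_D G U)\<^sup>2 + (norm_L2 G (lap_array G U))\<^sup>2))"

subsection \<open>The scheme\<close>

(* The boundary conditions enter through the reflected extension in lap_array and bilap_array. *)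
definition numerical_solution ::
  "mesh \<Rightarrow> real \<Rightarrow> real \<Rightarrow> real \<Rightarrow> (nat \<Rightarrow> array) \<Rightarrow> bool" where
  "numerical_solution G \<epsilon> \<eta> dt U \<longleftrightarrow>
     (\<forall>n. \<forall>i \<le> nx G. \<forall>j \<le> ny G. \<forall>k \<le> nz G.
        (U (Suc n) i j k - U n i j k) / dt =
          (if \<eta> < 1
           then - ((U n i j k) ^ 3
                   + ((1 - \<eta>) * U (Suc n) i j k + \<epsilon> * bilap_array G (U (Suc n)) i j k)
                   + 2 * lap_array G (U n) i j k)
           else - ((U n i j k) ^ 3
                   + \<epsilon> * bilap_array G (U (Suc n)) i j k
                   - ((\<eta> - 1) * U n i j k - 2 * lap_array G (U n) i j k))))"

definition coercivity_const :: "real \<Rightarrow> real \<Rightarrow> real \<Rightarrow> real" where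
  "coercivity_const \<epsilon> \<eta> \<zeta> =
     (\<epsilon> + 1 - \<eta> + \<zeta> - sqrt ((\<epsilon> - 1 + \<eta> - \<zeta>)\<^sup>2 + 4)) / 6"

definition sup_bound :: "mesh \<Rightarrow> real \<Rightarrow> real \<Rightarrow> real \<Rightarrow> real \<Rightarrow> array \<Rightarrow> real" where
  "sup_bound G C \<epsilon> \<eta> \<zeta> U0 =
     sqrt (C\<^sup>2 / coercivity_const \<epsilon> \<eta> \<zeta>
           * (energy G \<epsilon> \<eta> U0 + \<zeta>\<^sup>2 / 4 * lenx G * leny G * lenz G))"

end

theory Submission
  imports Defs
begin

text \<open>
  The difficulty is that the energy estimate needs a bound on \<open>U (Suc n)\<close> before one is available.
  It is circumvented by replacing the quartic potential outside \<open>[-M, M]\<close> by its second-order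
  Taylor polynomial. The truncated potential has second derivative at most \<open>3 * M\<^sup>2\<close> everywhere,
  so its energy decreases in a step from a state bounded by \<open>M\<close>; as \<open>M\<^sup>2 \<ge> \<zeta>\<close>, it still dominates
  \<open>\<zeta> / 2 * u\<^sup>2 - \<zeta>\<^sup>2 / 4\<close>, so its energy is coercive, and the discrete Sobolev inequality bounds the
  new state by \<open>M\<close>, where both energies agree.
\<close>

subsection \<open>Trapezoidal sums and summation by parts\<close>

lemma trap_sum_add: "trap_sum N (\<lambda>i. a i + b i) = trap_sum N a + trap_sum N b"
  by (simp add: trap_sum_def sum.distrib add_divide_distrib)

lemma trap_sum_cmult: "trap_sum N (\<lambda>i. c * a i) = c * trap_sum N a"
  by (simp add: trap_sum_def sum_distrib_left distrib_left)

lemma trap_sum_zero [simp]: "trap_sum N (\<lambda>i. 0) = 0"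
  by (simp add: trap_sum_def)

lemma trap_sum_const: "N > 0 \<Longrightarrow> trap_sum N (\<lambda>i. c) = real N * c"
  by (simp add: trap_sum_def of_nat_diff algebra_simps)

lemma trap_sum_mono: "(\<And>i. i \<le> N \<Longrightarrow> a i \<le> b i) \<Longrightarrow> trap_sum N a \<le> trap_sum N b"
  unfolding trap_sum_def by (intro add_mono divide_right_mono sum_mono) auto

lemma trap_sum_swap:
  "trap_sum N (\<lambda>i. trap_sum K (\<lambda>j. a i j)) = trap_sum K (\<lambda>j. trap_sum N (\<lambda>i. a i j))"
proof -
  have "(\<Sum>i = 1..<N. \<Sum>j = 1..<K. a i j) = (\<Sum>j = 1..<K. \<Sum>i = 1..<N. a i j)"
    by (rule sum.swap)
  then show ?thesis
    by (simp add: trap_sum_def sum.distrib add_divide_distrib sum_divide_distrib)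
qed

text \<open>The interior terms telescope to \<open>T (int N) - T 1\<close>. The half-weighted end
  terms turn this into two boundary averages, each of which vanishes when \<open>T\<close> changes
  sign across its boundary point.\<close>

lemma trap_sum_diff_shift:
  fixes T :: "int \<Rightarrow> real"
  assumes "N > 0"
  shows "trap_sum N (\<lambda>i. T (int i + 1) - T (int i))
    = (T (int N + 1) + T (int N)) / 2 - (T 1 + T 0) / 2"
proof -
  have "(\<Sum>i = 1..<N. T (int i + 1) - T (int i)) = T (int N) - T 1"
    using sum_Suc_diff'[of 1 N "\<lambda>i. T (int i)"] assms by (simp add: add.commute)
  then show ?thesis by (simp add: trap_sum_def field_simps)
qed

text \<open>The boundary terms cancel because \<open>(g i - g (i - 1)) * (h i + h (i - 1))\<close> is odd about the
  half-integer points next to a reflecting boundary.\<close>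

lemma trap_sum_by_parts:
  fixes g h :: "int \<Rightarrow> real"
  assumes "N > 0"
    and "g (- 1) = g 1" "g (int N + 1) = g (int N - 1)"
    and "h (- 1) = h 1" "h (int N + 1) = h (int N - 1)"
  shows "trap_sum N (\<lambda>i. (g (int i + 1) - 2 * g (int i) + g (int i - 1)) * h (int i)
     + ((g (int i + 1) - g (int i)) * (h (int i + 1) - h (int i))
      + (g (int i) - g (int i - 1)) * (h (int i) - h (int i - 1))) / 2) = 0"
proof -
  \<comment> \<open>\<open>T i\<close> belongs to the edge between \<open>i - 1\<close> and
    \<open>i\<close>: the increment of \<open>g\<close> times the mean of \<open>h\<close>. Writing
    each mean as \<open>h i\<close> plus or minus half an increment of \<open>h\<close> turns
    \<open>T (i + 1) - T i\<close> into a discrete product rule, with the products of forward and of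
    backward increments averaged.\<close>
  define T where "T i = (g i - g (i - 1)) * (h i + h (i - 1)) / 2" for i
  have "T (int N + 1) + T (int N) = 0" "T 1 + T 0 = 0"
    using assms by (simp_all add: T_def field_simps)
  then have "trap_sum N (\<lambda>i. T (int i + 1) - T (int i)) = 0"
    by (simp add: trap_sum_diff_shift[OF assms(1)])
  moreover have "(g (i + 1) - 2 * g i + g (i - 1)) * h i
     + ((g (i + 1) - g i) * (h (i + 1) - h i) + (g i - g (i - 1)) * (h i - h (i - 1))) / 2
     = T (i + 1) - T i" for i
    by (simp add: T_def field_simps)
  ultimately show ?thesis by simp
qed

subsection \<open>The discrete integral\<close>

text \<open>The cell volume stays inside the sum, as in \<open>energy\<close> and the norms, so that
  these fold into \<open>mesh_int\<close> directly.\<close>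

definition mesh_int :: "mesh \<Rightarrow> array \<Rightarrow> real" where
  "mesh_int G a = grid_sum G (\<lambda>i j k. a i j k * dx G * dy G * dz G)"

lemma grid_sum_rotate:
  "grid_sum G a
    = trap_sum (ny G) (\<lambda>j. trap_sum (nz G) (\<lambda>k. trap_sum (nx G) (\<lambda>i. a i j k)))"
  "grid_sum G a
    = trap_sum (nx G) (\<lambda>i. trap_sum (nz G) (\<lambda>k. trap_sum (ny G) (\<lambda>j. a i j k)))"
  unfolding grid_sum_def
  by (simp_all add: trap_sum_swap[of "nx G"] trap_sum_swap[of "ny G" "nz G"])

lemma mesh_int_add: "mesh_int G (\<lambda>i j k. a i j k + b i j k) = mesh_int G a + mesh_int G b"
  by (simp add: mesh_int_def grid_sum_def trap_sum_add distrib_right)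

lemma mesh_int_cmult: "mesh_int G (\<lambda>i j k. c * a i j k) = c * mesh_int G a"
  by (simp add: mesh_int_def grid_sum_def trap_sum_cmult mult.assoc)

lemma mesh_int_diff: "mesh_int G (\<lambda>i j k. a i j k - b i j k) = mesh_int G a - mesh_int G b"
  using mesh_int_add[of G a "\<lambda>i j k. (- 1) * b i j k"] mesh_int_cmult[of G "- 1" b] by simp

lemma valid_mesh_pos:
  assumes "valid_mesh G"
  shows "dx G > 0" "dy G > 0" "dz G > 0" "nx G > 0" "ny G > 0" "nz G > 0"
  using assms by (simp_all add: valid_mesh_def dx_def dy_def dz_def)

lemma mesh_int_mono:
  assumes "valid_mesh G"
    and "\<And>i j k. i \<le> nx G \<Longrightarrow> j \<le> ny G \<Longrightarrow> k \<le> nz G \<Longrightarrow> a i j k \<le> b i j k"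
  shows "mesh_int G a \<le> mesh_int G b"
  unfolding mesh_int_def grid_sum_def
  using assms(2) valid_mesh_pos[OF assms(1)]
  by (intro trap_sum_mono mult_right_mono) simp_all

lemma mesh_int_cong:
  assumes "valid_mesh G"
    and "\<And>i j k. i \<le> nx G \<Longrightarrow> j \<le> ny G \<Longrightarrow> k \<le> nz G \<Longrightarrow> a i j k = b i j k"
  shows "mesh_int G a = mesh_int G b"
  using assms by (intro antisym mesh_int_mono) simp_all

lemma mesh_int_nonneg:
  assumes "valid_mesh G" and "\<And>i j k. 0 \<le> a i j k"
  shows "0 \<le> mesh_int G a"
  using mesh_int_mono[OF assms(1), of "\<lambda>i j k. 0" a] assms(2) by (simp add: mesh_int_def grid_sum_def)

lemma mesh_int_const:
  assumes "valid_mesh G"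
  shows "mesh_int G (\<lambda>i j k. c) = c * lenx G * leny G * lenz G"
  using valid_mesh_pos[OF assms]
  by (simp add: mesh_int_def grid_sum_def trap_sum_const dx_def dy_def dz_def)

text \<open>Reduces a vanishing integral to one-dimensional identities along the lines of a single
  direction. The factor \<open>c\<close> will be the inverse squared mesh size of that
  direction.\<close>

lemma mesh_int_cmult_lines_eq_0:
  "(\<And>j k. trap_sum (nx G) (\<lambda>i. a i j k) = 0) \<Longrightarrow> mesh_int G (\<lambda>i j k. c * a i j k) = 0"
  "(\<And>i k. trap_sum (ny G) (\<lambda>j. a i j k) = 0) \<Longrightarrow> mesh_int G (\<lambda>i j k. c * a i j k) = 0"
  "(\<And>i j. trap_sum (nz G) (\<lambda>k. a i j k) = 0) \<Longrightarrow> mesh_int G (\<lambda>i j k. c * a i j k) = 0"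
proof -
  have vol: "mesh_int G (\<lambda>i j k. c * a i j k) = (c * dx G * dy G * dz G) * grid_sum G a"
    by (simp add: mesh_int_def grid_sum_def mult_ac flip: trap_sum_cmult)
  show "(\<And>j k. trap_sum (nx G) (\<lambda>i. a i j k) = 0) \<Longrightarrow> mesh_int G (\<lambda>i j k. c * a i j k) = 0"
    by (simp add: vol grid_sum_rotate(1))
  show "(\<And>i k. trap_sum (ny G) (\<lambda>j. a i j k) = 0) \<Longrightarrow> mesh_int G (\<lambda>i j k. c * a i j k) = 0"
    by (simp add: vol grid_sum_rotate(2))
  show "(\<And>i j. trap_sum (nz G) (\<lambda>k. a i j k) = 0) \<Longrightarrow> mesh_int G (\<lambda>i j k. c * a i j k) = 0"
    by (simp add: vol grid_sum_def)
qed

section \<open>Green's formula for the discrete Laplacian\<close>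

definition grad_dot :: "mesh \<Rightarrow> lattice \<Rightarrow> lattice \<Rightarrow> lattice" where
  "grad_dot G f g = (\<lambda>i j k.
     ((Dxp G f i j k * Dxp G g i j k + Dyp G f i j k * Dyp G g i j k + Dzp G f i j k * Dzp G g i j k)
    + (Dxm G f i j k * Dxm G g i j k + Dym G f i j k * Dym G g i j k + Dzm G f i j k * Dzm G g i j k))
    / 2)"

lemma ext_boundary:
  "ext G U (- 1) j k = ext G U 1 j k" "ext G U (int (nx G) + 1) j k = ext G U (int (nx G) - 1) j k"
  "ext G U i (- 1) k = ext G U i 1 k" "ext G U i (int (ny G) + 1) k = ext G U i (int (ny G) - 1) k"
  "ext G U i j (- 1) = ext G U i j 1" "ext G U i j (int (nz G) + 1) = ext G U i j (int (nz G) - 1)"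
  by (simp_all add: ext_def reflect_mirror reflect_uminus[of _ 1])

text \<open>The three directions are treated separately, by one-dimensional summation by parts along
  grid lines; even reflection removes the boundary terms.\<close>

lemma mesh_int_by_parts:
  assumes "valid_mesh G"
  shows "mesh_int G (\<lambda>i j k. lap_array G U i j k * W i j k)
    = - mesh_int G (\<lambda>i j k. grad_dot G (ext G U) (ext G W) (int i) (int j) (int k))"
proof -
  note pos = valid_mesh_pos[OF assms]
  define f where "f = ext G U"
  define g where "g = ext G W"
  \<comment> \<open>The summand of \<open>trap_sum_by_parts\<close> with the mesh size scaled out,
    as a function of three adjacent values of each function. In \<open>X\<close>, \<open>Y\<close>,
    \<open>Z\<close> only the summed index is a natural number; the transverse ones are arbitrary
    integers, as the reflection symmetry holds on every lattice line.\<close>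
  define q :: "real \<Rightarrow> real \<Rightarrow> real \<Rightarrow> real \<Rightarrow> real \<Rightarrow> real \<Rightarrow> real" where
    "q a b c a' b' c' = (a - 2 * b + c) * b' + ((a - b) * (a' - b') + (b - c) * (b' - c')) / 2"
    for a b c a' b' c'
  define X where "X i j k = q (f (int i + 1) j k) (f (int i) j k) (f (int i - 1) j k)
    (g (int i + 1) j k) (g (int i) j k) (g (int i - 1) j k)" for i j k
  define Y where "Y i j k = q (f i (int j + 1) k) (f i (int j) k) (f i (int j - 1) k)
    (g i (int j + 1) k) (g i (int j) k) (g i (int j - 1) k)" for i j k
  define Z where "Z i j k = q (f i j (int k + 1)) (f i j (int k)) (f i j (int k - 1))
    (g i j (int k + 1)) (g i j (int k)) (g i j (int k - 1))" for i j k
  have bd: "f (- 1) j k = f 1 j k" "f (int (nx G) + 1) j k = f (int (nx G) - 1) j k"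
    "f i (- 1) k = f i 1 k" "f i (int (ny G) + 1) k = f i (int (ny G) - 1) k"
    "f i j (- 1) = f i j 1" "f i j (int (nz G) + 1) = f i j (int (nz G) - 1)"
    "g (- 1) j k = g 1 j k" "g (int (nx G) + 1) j k = g (int (nx G) - 1) j k"
    "g i (- 1) k = g i 1 k" "g i (int (ny G) + 1) k = g i (int (ny G) - 1) k"
    "g i j (- 1) = g i j 1" "g i j (int (nz G) + 1) = g i j (int (nz G) - 1)" for i j k
    unfolding f_def g_def by (fact ext_boundary)+
  have X0: "trap_sum (nx G) (\<lambda>i. X i j k) = 0" for j k
    unfolding X_def q_def by (rule trap_sum_by_parts) (simp_all only: bd pos)
  have Y0: "trap_sum (ny G) (\<lambda>j. Y i j k) = 0" for i k
    unfolding Y_def q_def by (rule trap_sum_by_parts) (simp_all only: bd pos)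
  have Z0: "trap_sum (nz G) (\<lambda>k. Z i j k) = 0" for i j
    unfolding Z_def q_def by (rule trap_sum_by_parts) (simp_all only: bd pos)
  have int0: "mesh_int G (\<lambda>i j k. 1 / (dx G)\<^sup>2 * X i (int j) (int k)) = 0"
    "mesh_int G (\<lambda>i j k. 1 / (dy G)\<^sup>2 * Y (int i) j (int k)) = 0"
    "mesh_int G (\<lambda>i j k. 1 / (dz G)\<^sup>2 * Z (int i) (int j) k) = 0"
    by (rule mesh_int_cmult_lines_eq_0, rule X0 Y0 Z0)+
  have "mesh_int G (\<lambda>i j k. lap_array G U i j k * W i j k
      + grad_dot G f g (int i) (int j) (int k))
    = mesh_int G (\<lambda>i j k. 1 / (dx G)\<^sup>2 * X i (int j) (int k)
      + 1 / (dy G)\<^sup>2 * Y (int i) j (int k) + 1 / (dz G)\<^sup>2 * Z (int i) (int j) k)"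
  proof (rule mesh_int_cong[OF assms])
    fix i j k assume "i \<le> nx G" "j \<le> ny G" "k \<le> nz G"
    then have W: "W i j k = g (int i) (int j) (int k)" by (simp add: g_def ext_grid)
    have quot: "((a - b) / d - (b - c) / d) / d * b'
        + ((a - b) / d * ((a' - b') / d) + (b - c) / d * ((b' - c') / d)) / 2
        = 1 / d\<^sup>2 * q a b c a' b' c'" if "d > 0" for a b c a' b' c' d :: real
      using that by (simp add: q_def field_simps power2_eq_square)
    show "lap_array G U i j k * W i j k + grad_dot G f g (int i) (int j) (int k)
      = 1 / (dx G)\<^sup>2 * X i (int j) (int k)
      + 1 / (dy G)\<^sup>2 * Y (int i) j (int k) + 1 / (dz G)\<^sup>2 * Z (int i) (int j) k"
      unfolding X_def Y_def Z_def quot[OF pos(1), symmetric] quot[OF pos(2), symmetric]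
        quot[OF pos(3), symmetric] W lap_array_def f_def[symmetric]
      by (simp add: lap_def grad_dot_def Dxp_def Dyp_def Dzp_def Dxm_def Dym_def Dzm_def
          distrib_right add_divide_distrib)
  qed
  then show ?thesis by (simp only: mesh_int_add int0 f_def g_def)
qed

lemma lap_array_symmetric:
  assumes "valid_mesh G"
  shows "mesh_int G (\<lambda>i j k. lap_array G U i j k * W i j k)
    = mesh_int G (\<lambda>i j k. U i j k * lap_array G W i j k)"
proof -
  have "grad_dot G (ext G U) (ext G W) = grad_dot G (ext G W) (ext G U)"
    by (simp add: grad_dot_def mult.commute)
  then have "mesh_int G (\<lambda>i j k. lap_array G U i j k * W i j k)
    = mesh_int G (\<lambda>i j k. lap_array G W i j k * U i j k)"
    by (simp add: mesh_int_by_parts[OF assms])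
  then show ?thesis by (simp only: mult.commute)
qed

text \<open>Eliminates gradients from the energy and the seminorm. Afterwards every integrand
  depends only on the values of \<open>U\<close> and \<open>lap_array G U\<close> at one grid point,
  so inequalities can be proved pointwise.\<close>

lemma mesh_int_grad_sq:
  assumes "valid_mesh G"
  shows "mesh_int G (\<lambda>i j k. grad_sq G (ext G U) (int i) (int j) (int k))
    = - mesh_int G (\<lambda>i j k. lap_array G U i j k * U i j k)"
proof -
  have "grad_sq G (ext G U) = grad_dot G (ext G U) (ext G U)"
    by (simp add: grad_sq_def grad_dot_def power2_eq_square)
  then show ?thesis by (simp add: mesh_int_by_parts[OF assms])
qed

section \<open>Linearity of the Laplacian, and the norms as integrals\<close>

lemma lap_array_diff:
  "lap_array G (\<lambda>i j k. V i j k - U i j k) i j k = lap_array G V i j k - lap_array G U i j k"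
  by (simp add: lap_array_def ext_def lap_def Dxp_def Dyp_def Dzp_def Dxm_def Dym_def Dzm_def
      diff_divide_distrib add_divide_distrib)

lemma norm_L2_sq: "valid_mesh G \<Longrightarrow> (norm_L2 G U)\<^sup>2 = mesh_int G (\<lambda>i j k. (U i j k)\<^sup>2)"
  using mesh_int_nonneg[of G "\<lambda>i j k. (U i j k)\<^sup>2"] by (simp add: norm_L2_def mesh_int_def)

lemma seminorm_D_sq:
  assumes "valid_mesh G"
  shows "(seminorm_D G U)\<^sup>2 = - mesh_int G (\<lambda>i j k. lap_array G U i j k * U i j k)"
proof -
  have "(seminorm_D G U)\<^sup>2 = mesh_int G (\<lambda>i j k. grad_sq G (ext G U) (int i) (int j) (int k))"
    using mesh_int_nonneg[OF assms, of "\<lambda>i j k. grad_sq G (ext G U) (int i) (int j) (int k)"]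
    by (simp add: seminorm_D_def mesh_int_def grad_sq_def)
  then show ?thesis by (simp add: mesh_int_grad_sq[OF assms])
qed

lemma abs_le_norm_Linf:
  assumes "i \<le> nx G" "j \<le> ny G" "k \<le> nz G"
  shows "\<bar>U i j k\<bar> \<le> norm_Linf G U"
proof -
  have "{\<bar>U i j k\<bar> |i j k. i \<le> nx G \<and> j \<le> ny G \<and> k \<le> nz G}
    \<subseteq> (\<lambda>(i, j, k). \<bar>U i j k\<bar>) ` ({..nx G} \<times> {..ny G} \<times> {..nz G})"
    by force
  then have "finite {\<bar>U i j k\<bar> |i j k. i \<le> nx G \<and> j \<le> ny G \<and> k \<le> nz G}"
    by (rule finite_subset) simp
  then show ?thesis unfolding norm_Linf_def using assms by (intro Max_ge) auto
qed

subsection \<open>The energy of a general potential\<close>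

text \<open>The potential \<open>F\<close> is a parameter so that the quartic and its truncation
  share one theory. The gradient term of \<open>energy\<close> appears in its integrated-by-parts
  form, which explains the plus sign.\<close>

definition energy_pot :: "mesh \<Rightarrow> (real \<Rightarrow> real) \<Rightarrow> real \<Rightarrow> real \<Rightarrow> array \<Rightarrow> real" where
  "energy_pot G F \<epsilon> \<eta> U = mesh_int G (\<lambda>i j k. F (U i j k) + (1 - \<eta>) / 2 * (U i j k)\<^sup>2
     + lap_array G U i j k * U i j k + \<epsilon> / 2 * (lap_array G U i j k)\<^sup>2)"

lemma energy_eq_energy_pot:
  assumes "valid_mesh G"
  shows "energy G \<epsilon> \<eta> U = energy_pot G (\<lambda>u. 1 / 4 * u ^ 4) \<epsilon> \<eta> U"
  unfolding energy_def mesh_int_def[symmetric] energy_pot_def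
  by (simp only: mesh_int_add mesh_int_diff mesh_int_grad_sq[OF assms])

lemma energy_pot_cong:
  assumes "valid_mesh G"
    and "\<And>i j k. i \<le> nx G \<Longrightarrow> j \<le> ny G \<Longrightarrow> k \<le> nz G \<Longrightarrow> F (U i j k) = F' (U i j k)"
  shows "energy_pot G F \<epsilon> \<eta> U = energy_pot G F' \<epsilon> \<eta> U"
  unfolding energy_pot_def using assms by (intro mesh_int_cong) simp_all

text \<open>With \<open>a = 1 - \<eta> + \<zeta>\<close>, three times the coercivity constant is the smaller eigenvalue of the
  matrix of the quadratic form \<open>a * u\<^sup>2 + 2 * u * d + \<epsilon> * d\<^sup>2\<close>.\<close>

lemma coercivity_const_bounds:
  assumes "\<epsilon> > 0" "\<zeta> > 1 / \<epsilon> + \<eta> - 1"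
  shows "coercivity_const \<epsilon> \<eta> \<zeta> > 0"
    and "(1 - \<eta> + \<zeta>) / 2 * u\<^sup>2 + d * u + \<epsilon> / 2 * d\<^sup>2
      \<ge> coercivity_const \<epsilon> \<eta> \<zeta> * (u\<^sup>2 - d * u + d\<^sup>2)"
proof -
  define a where "a = 1 - \<eta> + \<zeta>"
  define c where "c = coercivity_const \<epsilon> \<eta> \<zeta>"
  define r where "r = sqrt ((a - \<epsilon>)\<^sup>2 + 4)"
  have r2: "r\<^sup>2 = (a - \<epsilon>)\<^sup>2 + 4" by (simp add: r_def)
  have "(\<epsilon> - 1 + \<eta> - \<zeta>)\<^sup>2 = (a - \<epsilon>)\<^sup>2" by (simp add: a_def power2_eq_square algebra_simps)
  then have c: "6 * c = a + \<epsilon> - r"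
    by (simp add: c_def coercivity_const_def r_def a_def)
  \<comment> \<open>The hypothesis on \<zeta> says \<open>a * \<epsilon> > 1\<close>, which makes
    the matrix positive definite. It gives \<open>r < a + \<epsilon>\<close>, hence
    \<open>c > 0\<close>.\<close>
  have a: "a > 1 / \<epsilon>" using assms(2) by (simp add: a_def)
  then have "a * \<epsilon> > 1" using assms(1) by (simp add: field_simps)
  moreover have a0: "a > 0" using a assms(1) by (meson less_trans zero_less_divide_1_iff)
  ultimately have "r\<^sup>2 < (a + \<epsilon>)\<^sup>2" unfolding r2 by (simp add: power2_eq_square algebra_simps)
  then have "r < a + \<epsilon>" using a0 assms(1) by (simp add: power2_less_imp_less)
  then have c0: "c > 0" using c by simp
  have "r > \<bar>a - \<epsilon>\<bar>"
    unfolding r_def by (intro real_less_rsqrt) simp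
  then have p: "a - 3 * c > 0" using c by argo
  \<comment> \<open>The characteristic equation at the eigenvalue \<open>3 * c\<close>: the shifted
    matrix is singular, so its quadratic form becomes a perfect square after multiplication by the
    positive entry \<open>a - 3 * c\<close>.\<close>
  have prod: "(a - 3 * c) * (\<epsilon> - 3 * c) = 1"
  proof -
    have "3 * c = (a + \<epsilon> - r) / 2" using c by simp
    then have "4 * ((a - 3 * c) * (\<epsilon> - 3 * c)) = r\<^sup>2 - (a - \<epsilon>)\<^sup>2"
      by (simp only:) (simp add: field_simps power2_eq_square)
    then show ?thesis using r2 by simp
  qed
  have "(a - 3 * c) * ((a - 3 * c) * u\<^sup>2 + 2 * u * d + (\<epsilon> - 3 * c) * d\<^sup>2)
      = ((a - 3 * c) * u)\<^sup>2 + 2 * (a - 3 * c) * u * d + ((a - 3 * c) * (\<epsilon> - 3 * c)) * d\<^sup>2"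
    by (simp add: power2_eq_square algebra_simps)
  also have "\<dots> = ((a - 3 * c) * u + d)\<^sup>2"
    unfolding prod by (simp add: power2_eq_square algebra_simps)
  finally have "0 \<le> (a - 3 * c) * ((a - 3 * c) * u\<^sup>2 + 2 * u * d + (\<epsilon> - 3 * c) * d\<^sup>2)" by simp
  then have "0 \<le> (a - 3 * c) * u\<^sup>2 + 2 * u * d + (\<epsilon> - 3 * c) * d\<^sup>2"
    using p by (simp add: zero_le_mult_iff)
  \<comment> \<open>Source of the factor 3: \<open>u\<^sup>2 - d * u + d\<^sup>2\<close> equals
    \<open>3 / 2 * (u\<^sup>2 + d\<^sup>2) - (u + d)\<^sup>2 / 2\<close>, so half of the eigenvalue
    bound by \<open>3 * c\<close> suffices.\<close>
  moreover have "0 \<le> c * (u + d)\<^sup>2" using c0 by simp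
  ultimately have "a / 2 * u\<^sup>2 + d * u + \<epsilon> / 2 * d\<^sup>2 \<ge> c * (u\<^sup>2 - d * u + d\<^sup>2)"
    by (simp add: power2_eq_square algebra_simps)
  with c0 show "coercivity_const \<epsilon> \<eta> \<zeta> > 0"
    "(1 - \<eta> + \<zeta>) / 2 * u\<^sup>2 + d * u + \<epsilon> / 2 * d\<^sup>2
      \<ge> coercivity_const \<epsilon> \<eta> \<zeta> * (u\<^sup>2 - d * u + d\<^sup>2)"
    by (simp_all add: a_def c_def)
qed

text \<open>By Green's formula \<open>- d * u\<close> with \<open>d = lap_array G U\<close>
  integrates to the squared seminorm, so the claim follows by integrating the pointwise form
  inequality. The lower bound on \<open>F\<close> shifts the coefficient \<open>1 - \<eta>\<close>
  by \<zeta>, and its constant integrates to the volume term.\<close>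

lemma energy_pot_coercive:
  assumes G: "valid_mesh G" and "\<epsilon> > 0" "\<zeta> > 1 / \<epsilon> + \<eta> - 1"
    and F: "\<And>u. \<zeta> / 2 * u\<^sup>2 - \<zeta>\<^sup>2 / 4 \<le> F u"
  shows "coercivity_const \<epsilon> \<eta> \<zeta>
      * ((norm_L2 G U)\<^sup>2 + (seminorm_D G U)\<^sup>2 + (norm_L2 G (lap_array G U))\<^sup>2)
    \<le> energy_pot G F \<epsilon> \<eta> U + \<zeta>\<^sup>2 / 4 * lenx G * leny G * lenz G"
proof -
  let ?c = "coercivity_const \<epsilon> \<eta> \<zeta>" and ?d = "lap_array G U"
  have "?c * ((norm_L2 G U)\<^sup>2 + (seminorm_D G U)\<^sup>2 + (norm_L2 G ?d)\<^sup>2)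
    = mesh_int G (\<lambda>i j k. ?c * ((U i j k)\<^sup>2 - ?d i j k * U i j k + (?d i j k)\<^sup>2))"
    by (simp only: mesh_int_cmult mesh_int_add mesh_int_diff norm_L2_sq[OF G] seminorm_D_sq[OF G])
      simp
  also have "\<dots> \<le> mesh_int G (\<lambda>i j k. (F (U i j k) + (1 - \<eta>) / 2 * (U i j k)\<^sup>2
     + ?d i j k * U i j k + \<epsilon> / 2 * (?d i j k)\<^sup>2) + \<zeta>\<^sup>2 / 4)"
  proof (rule mesh_int_mono[OF G])
    fix i j k
    show "?c * ((U i j k)\<^sup>2 - ?d i j k * U i j k + (?d i j k)\<^sup>2)
      \<le> (F (U i j k) + (1 - \<eta>) / 2 * (U i j k)\<^sup>2
     + ?d i j k * U i j k + \<epsilon> / 2 * (?d i j k)\<^sup>2) + \<zeta>\<^sup>2 / 4"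
      using coercivity_const_bounds(2)[OF assms(2,3), of "U i j k" "?d i j k"] F[of "U i j k"]
      by (simp add: add_divide_distrib diff_divide_distrib algebra_simps)
  qed
  also have "\<dots> = energy_pot G F \<epsilon> \<eta> U + \<zeta>\<^sup>2 / 4 * lenx G * leny G * lenz G"
    unfolding energy_pot_def by (subst mesh_int_add) (simp only: mesh_int_const[OF G])
  finally show ?thesis .
qed

text \<open>Combines coercivity with the discrete Sobolev inequality. It serves twice: with the
  quartic for the initial state, and with the truncated potential for each new state.\<close>

lemma norm_Linf_le_sup_bound:
  assumes G: "valid_mesh G" and C: "discrete_sobolev_const (lenx G) (leny G) (lenz G) C"
    and par: "\<epsilon> > 0" "\<zeta> > 1 / \<epsilon> + \<eta> - 1"
    and F: "\<And>u. \<zeta> / 2 * u\<^sup>2 - \<zeta>\<^sup>2 / 4 \<le> F u"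
    and le: "energy_pot G F \<epsilon> \<eta> U \<le> energy G \<epsilon> \<eta> U0"
  shows "norm_Linf G U \<le> sup_bound G C \<epsilon> \<eta> \<zeta> U0"
proof -
  let ?c = "coercivity_const \<epsilon> \<eta> \<zeta>"
  define S where "S = (norm_L2 G U)\<^sup>2 + (seminorm_D G U)\<^sup>2 + (norm_L2 G (lap_array G U))\<^sup>2"
  define E where "E = energy G \<epsilon> \<eta> U0 + \<zeta>\<^sup>2 / 4 * lenx G * leny G * lenz G"
  have c: "?c > 0" by (rule coercivity_const_bounds(1)[OF par])
  have C0: "C > 0" and "norm_Linf G U \<le> C * sqrt S"
    using C G unfolding discrete_sobolev_const_def S_def by blast+
  have "?c * S \<le> E"
    using energy_pot_coercive[OF G par F, of U] le unfolding S_def E_def by linarith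
  then have "S \<le> E / ?c" using c by (simp add: field_simps)
  then have "C\<^sup>2 * S \<le> C\<^sup>2 / ?c * E" using mult_left_mono[of S "E / ?c" "C\<^sup>2"] by simp
  then have "sqrt (C\<^sup>2 * S) \<le> sup_bound G C \<epsilon> \<eta> \<zeta> U0"
    by (simp add: sup_bound_def E_def)
  then show ?thesis using \<open>norm_Linf G U \<le> C * sqrt S\<close> C0 by (simp add: real_sqrt_mult)
qed

subsection \<open>The truncated quartic potential\<close>

text \<open>\<open>M ^ 3\<close> and \<open>3 * M\<^sup>2\<close> are the first two derivatives of
  the quartic at \<open>M\<close>; the absolute value covers the expansion at \<open>- M\<close> by
  evenness.\<close>

definition trunc_pot :: "real \<Rightarrow> real \<Rightarrow> real" where
  "trunc_pot M u = (if \<bar>u\<bar> \<le> M then 1 / 4 * u ^ 4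
     else 1 / 4 * M ^ 4 + M ^ 3 * (\<bar>u\<bar> - M) + 3 / 2 * M\<^sup>2 * (\<bar>u\<bar> - M)\<^sup>2)"

lemma quartic_lower: "\<zeta> / 2 * u\<^sup>2 - \<zeta>\<^sup>2 / 4 \<le> 1 / 4 * (u::real) ^ 4"
proof -
  have "1 / 4 * u ^ 4 - (\<zeta> / 2 * u\<^sup>2 - \<zeta>\<^sup>2 / 4) = ((u\<^sup>2 - \<zeta>) / 2)\<^sup>2"
    by (simp add: power2_eq_square power3_eq_cube power4_eq_xxxx field_simps)
  also have "\<dots> \<ge> 0" by simp
  finally show ?thesis by (simp only: diff_ge_0_iff_ge)
qed

lemma trunc_pot_lower:
  assumes "M \<ge> 0" "\<zeta> \<le> M\<^sup>2"
  shows "\<zeta> / 2 * u\<^sup>2 - \<zeta>\<^sup>2 / 4 \<le> trunc_pot M u"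
proof (cases "\<bar>u\<bar> \<le> M")
  case True
  then show ?thesis using quartic_lower by (simp add: trunc_pot_def)
next
  case False
  define d where "d = \<bar>u\<bar> - M"
  have d: "d \<ge> 0" "\<bar>u\<bar> = M + d" using False by (simp_all add: d_def)
  have u2: "u\<^sup>2 = (M + d)\<^sup>2" using d(2) by (metis power2_abs)
  have "trunc_pot M u = 1 / 4 * M ^ 4 + M ^ 3 * d + 3 / 2 * M\<^sup>2 * d\<^sup>2"
    using False by (simp add: trunc_pot_def d(2))
  then have "trunc_pot M u - (\<zeta> / 2 * u\<^sup>2 - \<zeta>\<^sup>2 / 4)
      = 1 / 4 * M ^ 4 + M ^ 3 * d + 3 / 2 * M\<^sup>2 * d\<^sup>2 - (\<zeta> / 2 * (M + d)\<^sup>2 - \<zeta>\<^sup>2 / 4)"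
    by (simp only: u2)
  \<comment> \<open>Expansion in powers of \<open>d\<close>. The quadratic coefficient involves
    \<open>3 * M\<^sup>2 - \<zeta>\<close>, split so that every coefficient is visibly nonnegative
    from \<open>\<zeta> \<le> M\<^sup>2\<close>.\<close>
  also have "\<dots> = ((M\<^sup>2 - \<zeta>) / 2)\<^sup>2 + d * M * (M\<^sup>2 - \<zeta>) + d\<^sup>2 / 2 * (2 * M\<^sup>2 + (M\<^sup>2 - \<zeta>))"
    by (simp add: power2_eq_square power3_eq_cube power4_eq_xxxx field_simps)
  also have "\<dots> \<ge> 0" using assms d by (intro add_nonneg_nonneg mult_nonneg_nonneg) simp_all
  finally show ?thesis by simp
qed

text \<open>The Taylor remainder of \<open>v ^ 4\<close> at \<open>u\<close> is
  \<open>(v - u)\<^sup>2\<close> times \<open>v\<^sup>2 + 2 * u * v + 3 * u\<^sup>2\<close>. The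
  second factor is at most \<open>2 * v\<^sup>2 + 4 * u\<^sup>2\<close>, hence at most
  \<open>6 * M\<^sup>2\<close>.\<close>

lemma quartic_taylor_upper:
  fixes u v :: real
  assumes "\<bar>u\<bar> \<le> M" "\<bar>v\<bar> \<le> M"
  shows "1 / 4 * v ^ 4 \<le> 1 / 4 * u ^ 4 + u ^ 3 * (v - u) + 3 / 2 * M\<^sup>2 * (v - u)\<^sup>2"
proof -
  have sq: "u\<^sup>2 \<le> M\<^sup>2" "v\<^sup>2 \<le> M\<^sup>2"
    using assms by (metis abs_ge_zero power2_abs power_mono)+
  have "0 \<le> (u - v)\<^sup>2" by simp
  then have "v\<^sup>2 + 2 * u * v + 3 * u\<^sup>2 \<le> 6 * M\<^sup>2"
    using sq by (simp add: power2_diff)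
  then have "0 \<le> (v - u)\<^sup>2 * (6 * M\<^sup>2 - (v\<^sup>2 + 2 * u * v + 3 * u\<^sup>2))" by simp
  then have "0 \<le> (v - u)\<^sup>2 * (6 * M\<^sup>2 - (v\<^sup>2 + 2 * u * v + 3 * u\<^sup>2)) / 4" by simp
  also have "\<dots> = 1 / 4 * u ^ 4 + u ^ 3 * (v - u) + 3 / 2 * M\<^sup>2 * (v - u)\<^sup>2 - 1 / 4 * v ^ 4"
    by (simp add: power2_eq_square power3_eq_cube power4_eq_xxxx field_simps)
  finally show ?thesis by (simp only: diff_ge_0_iff_ge)
qed

text \<open>Here \<open>v\<close> is unrestricted: \<open>u\<close> stands for the old state,
  already bounded by \<open>M\<close>, and \<open>v\<close> for the new one, not yet
  bounded.\<close>

lemma trunc_pot_taylor_upper: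
  assumes u: "\<bar>u\<bar> \<le> M"
  shows "trunc_pot M v \<le> 1 / 4 * u ^ 4 + u ^ 3 * (v - u) + 3 / 2 * M\<^sup>2 * (v - u)\<^sup>2"
proof -
  \<comment> \<open>Both sides are quadratic in \<open>v\<close> with leading coefficient
    \<open>3 / 2 * M\<^sup>2\<close>, so their difference is affine in \<open>v\<close>. It is
    nonnegative at \<open>v = M\<close> by the quartic estimate, and its slope is
    \<open>(M - u)\<^sup>2 * (2 * M + u)\<close>.\<close>
  have outside: "1 / 4 * M ^ 4 + M ^ 3 * (v - M) + 3 / 2 * M\<^sup>2 * (v - M)\<^sup>2
      \<le> 1 / 4 * u ^ 4 + u ^ 3 * (v - u) + 3 / 2 * M\<^sup>2 * (v - u)\<^sup>2"
    if u: "\<bar>u\<bar> \<le> M" and v: "v > M" for u v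
  proof -
    have "0 \<le> 1 / 4 * u ^ 4 + u ^ 3 * (M - u) + 3 / 2 * M\<^sup>2 * (M - u)\<^sup>2 - 1 / 4 * M ^ 4"
      using quartic_taylor_upper[OF u, of M] u by linarith
    moreover have "0 \<le> (v - M) * ((M - u) * ((M - u) * (2 * M + u)))"
      using u v by (intro mult_nonneg_nonneg) linarith+
    ultimately have "0 \<le> (1 / 4 * u ^ 4 + u ^ 3 * (M - u) + 3 / 2 * M\<^sup>2 * (M - u)\<^sup>2 - 1 / 4 * M ^ 4)
      + (v - M) * ((M - u) * ((M - u) * (2 * M + u)))" by (rule add_nonneg_nonneg)
    also have "\<dots> = 1 / 4 * u ^ 4 + u ^ 3 * (v - u) + 3 / 2 * M\<^sup>2 * (v - u)\<^sup>2
      - (1 / 4 * M ^ 4 + M ^ 3 * (v - M) + 3 / 2 * M\<^sup>2 * (v - M)\<^sup>2)"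
      by (simp add: power2_eq_square power3_eq_cube power4_eq_xxxx field_simps)
    finally show ?thesis by (simp only: diff_ge_0_iff_ge)
  qed
  show ?thesis
  proof (cases "\<bar>v\<bar> \<le> M")
    case True
    then show ?thesis using quartic_taylor_upper[OF u] by (simp add: trunc_pot_def)
  next
    case False
    then consider "v > M" | "- v > M" by linarith
    then show ?thesis
    proof cases
      case 1
      then show ?thesis using outside[OF u 1] u by (simp add: trunc_pot_def)
    next
      case 2
      have "trunc_pot M v = 1 / 4 * M ^ 4 + M ^ 3 * (- v - M) + 3 / 2 * M\<^sup>2 * (- v - M)\<^sup>2"
        using 2 u by (simp add: trunc_pot_def)
      also have "\<dots> \<le> 1 / 4 * (- u) ^ 4 + (- u) ^ 3 * (- v - - u) + 3 / 2 * M\<^sup>2 * (- v - - u)\<^sup>2"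
        using u 2 by (intro outside) simp_all
      also have "\<dots> = 1 / 4 * u ^ 4 + u ^ 3 * (v - u) + 3 / 2 * M\<^sup>2 * (v - u)\<^sup>2" by algebra
      finally show ?thesis .
    qed
  qed
qed

subsection \<open>Energy dissipation\<close>

text \<open>The scheme is tested with the increment \<open>w\<close> of the step. The concave
  gradient term is explicit and the convex bilaplacian term implicit, so both contribute with a
  favourable sign. The truncated potential costs at most
  \<open>3 / 2 * M\<^sup>2 * w\<^sup>2\<close>; the time difference and the
  \<open>1 - \<eta>\<close> term pay for it with
  \<open>(1 / dt + \<bar>1 - \<eta>\<bar> / 2) * w\<^sup>2\<close>, which the step size condition
  makes sufficient.\<close>

lemma energy_pot_step:
  assumes G: "valid_mesh G" and "\<epsilon> > 0" "dt > 0"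
    and sol: "numerical_solution G \<epsilon> \<eta> dt U"
    and dt: "3 * M\<^sup>2 \<le> \<bar>1 - \<eta>\<bar> \<or>
         3 * M\<^sup>2 > \<bar>1 - \<eta>\<bar> \<and> dt \<le> 2 / (3 * M\<^sup>2 - \<bar>1 - \<eta>\<bar>)"
    and bd: "\<And>i j k. i \<le> nx G \<Longrightarrow> j \<le> ny G \<Longrightarrow> k \<le> nz G \<Longrightarrow> \<bar>U n i j k\<bar> \<le> M"
  shows "energy_pot G (trunc_pot M) \<epsilon> \<eta> (U (Suc n)) \<le> energy G \<epsilon> \<eta> (U n)"
proof -
  define u v where "u = U n" and "v = U (Suc n)"
  define w where "w = (\<lambda>i j k. v i j k - u i j k)"
  define Lu Lv Lw Bv where "Lu = lap_array G u" and "Lv = lap_array G v"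
    and "Lw = lap_array G w" and "Bv = lap_array G Lv"
  have Lw: "Lw i j k = Lv i j k - Lu i j k" for i j k
    by (simp add: Lu_def Lv_def Lw_def w_def lap_array_diff)
  have step_size: "3 * M\<^sup>2 / 2 - \<bar>1 - \<eta>\<bar> / 2 \<le> 1 / dt"
  proof (cases "3 * M\<^sup>2 \<le> \<bar>1 - \<eta>\<bar>")
    case True
    then have "3 * M\<^sup>2 / 2 - \<bar>1 - \<eta>\<bar> / 2 \<le> 0" by simp
    also have "0 \<le> 1 / dt" using \<open>dt > 0\<close> by simp
    finally show ?thesis .
  next
    case False
    with dt have "dt \<le> 2 / (3 * M\<^sup>2 - \<bar>1 - \<eta>\<bar>)" "3 * M\<^sup>2 - \<bar>1 - \<eta>\<bar> > 0" by auto
    then show ?thesis using \<open>dt > 0\<close> by (simp add: field_simps)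
  qed
  txt \<open>On the right, both differences integrate to \<open>0\<close> by symmetry of the discrete Laplacian, and
    \<open>Lw * w\<close> integrates to minus the squared seminorm of \<open>w\<close>.\<close>
  have pointwise: "(trunc_pot M (v i j k) + (1 - \<eta>) / 2 * (v i j k)\<^sup>2
       + Lv i j k * v i j k + \<epsilon> / 2 * (Lv i j k)\<^sup>2)
     - (1 / 4 * (u i j k) ^ 4 + (1 - \<eta>) / 2 * (u i j k)\<^sup>2
       + Lu i j k * u i j k + \<epsilon> / 2 * (Lu i j k)\<^sup>2)
     \<le> Lw i j k * w i j k + (Lw i j k * u i j k - w i j k * Lu i j k)
       + \<epsilon> * (Lv i j k * Lw i j k - Bv i j k * w i j k)"
    if ijk: "i \<le> nx G" "j \<le> ny G" "k \<le> nz G" for i j k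
  proof -
    define x y p r b where "x = u i j k" and "y = v i j k" and "p = Lu i j k" and "r = Lv i j k"
      and "b = Bv i j k"
    \<comment> \<open>Written as the Laplacian of \<open>Lv\<close>, the bilaplacian becomes
      accessible to the symmetry of the Laplacian.\<close>
    have B: "bilap_array G (U (Suc n)) i j k = b"
      by (simp add: bilap_array_eq[OF G] b_def Bv_def Lv_def v_def)
    have taylor: "trunc_pot M y \<le> 1 / 4 * x ^ 4 + x ^ 3 * (y - x) + 3 / 2 * M\<^sup>2 * (y - x)\<^sup>2"
      using bd[OF ijk] unfolding x_def u_def by (rule trunc_pot_taylor_upper)
    have sch: "(y - x) / dt = (if \<eta> < 1 then - (x ^ 3 + ((1 - \<eta>) * y + \<epsilon> * b) + 2 * p)
        else - (x ^ 3 + \<epsilon> * b - ((\<eta> - 1) * x - 2 * p)))"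
      using sol ijk unfolding numerical_solution_def B[symmetric]
      by (simp add: x_def y_def p_def u_def v_def Lu_def)
    have "(3 * M\<^sup>2 / 2 - \<bar>1 - \<eta>\<bar> / 2) * (y - x)\<^sup>2 \<le> 1 / dt * (y - x)\<^sup>2"
      using step_size by (rule mult_right_mono) simp
    also have "\<dots> = (y - x) / dt * (y - x)" by (simp add: power2_eq_square)
    finally have small: "(3 * M\<^sup>2 / 2 - \<bar>1 - \<eta>\<bar> / 2) * (y - x)\<^sup>2 \<le> (y - x) / dt * (y - x)" .
    have poly: "1 / 4 * x ^ 4 + x ^ 3 * (y - x) + 3 / 2 * M\<^sup>2 * (y - x)\<^sup>2
        + (1 - \<eta>) / 2 * y\<^sup>2 - 1 / 4 * x ^ 4 - (1 - \<eta>) / 2 * x\<^sup>2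
        + 2 * p * (y - x) + \<epsilon> * b * (y - x) \<le> 0"
    \<comment> \<open>In the implicit case \<open>y\<^sup>2 - x\<^sup>2\<close> is expanded around
      \<open>y\<close>, in the explicit case around \<open>x\<close>. Either way, multiplying by
      \<open>(1 - \<eta>) / 2\<close> leaves the remainder
      \<open>- \<bar>1 - \<eta>\<bar> / 2 * (y - x)\<^sup>2\<close>.\<close>
    proof (cases "\<eta> < 1")
      case True
      then have "(3 * M\<^sup>2 / 2 - (1 - \<eta>) / 2) * (y - x)\<^sup>2
          \<le> - (x ^ 3 + ((1 - \<eta>) * y + \<epsilon> * b) + 2 * p) * (y - x)"
        using small sch by simp
      then show ?thesis by (simp add: power2_eq_square field_simps)
    next
      case False
      then have "(3 * M\<^sup>2 / 2 - (\<eta> - 1) / 2) * (y - x)\<^sup>2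
          \<le> - (x ^ 3 + \<epsilon> * b - ((\<eta> - 1) * x - 2 * p)) * (y - x)"
        using small sch by simp
      then show ?thesis by (simp add: power2_eq_square field_simps)
    qed
    \<comment> \<open>Convexity of the implicit term: dropping this square gives \<open>\<epsilon> /
      2 * (r\<^sup>2 - p\<^sup>2) \<le> \<epsilon> * r * (r - p)\<close>. The difference
      \<open>r * y - p * x\<close> is the explicit part \<open>2 * p * (y - x)\<close> plus the
      first two summands on the right.\<close>
    have "0 \<le> \<epsilon> / 2 * (r - p)\<^sup>2" using \<open>\<epsilon> > 0\<close> by simp
    then have "(trunc_pot M y + (1 - \<eta>) / 2 * y\<^sup>2 + r * y + \<epsilon> / 2 * r\<^sup>2)
       - (1 / 4 * x ^ 4 + (1 - \<eta>) / 2 * x\<^sup>2 + p * x + \<epsilon> / 2 * p\<^sup>2)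
       \<le> (r - p) * (y - x) + ((r - p) * x - (y - x) * p) + \<epsilon> * (r * (r - p) - b * (y - x))"
      using taylor poly by (simp add: power2_eq_square field_simps)
    then show ?thesis by (simp add: Lw w_def x_def y_def p_def r_def b_def)
  qed
  have "energy_pot G (trunc_pot M) \<epsilon> \<eta> v - energy G \<epsilon> \<eta> u
      \<le> mesh_int G (\<lambda>i j k. Lw i j k * w i j k + (Lw i j k * u i j k - w i j k * Lu i j k)
       + \<epsilon> * (Lv i j k * Lw i j k - Bv i j k * w i j k))"
    unfolding energy_eq_energy_pot[OF G] energy_pot_def mesh_int_diff[symmetric]
      Lu_def[symmetric] Lv_def[symmetric]
    by (rule mesh_int_mono[OF G pointwise])
  also have "\<dots> = mesh_int G (\<lambda>i j k. Lw i j k * w i j k)"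
    using lap_array_symmetric[OF G, of w u] lap_array_symmetric[OF G, of Lv w]
    by (simp only: mesh_int_add mesh_int_diff mesh_int_cmult Lu_def Lw_def Bv_def) simp
  also have "\<dots> = - (seminorm_D G w)\<^sup>2" by (simp add: seminorm_D_sq[OF G] Lw_def)
  also have "\<dots> \<le> 0" by simp
  finally show ?thesis by (simp add: u_def v_def)
qed

section \<open>Induction over the time steps\<close>

theorem theorem4p6:
  fixes G :: mesh and U :: "nat \<Rightarrow> array" and C \<epsilon> \<eta> \<zeta> dt M :: real
  assumes "valid_mesh G"
    and "discrete_sobolev_const (lenx G) (leny G) (lenz G) C"
    and "\<epsilon> > 0" and "dt > 0"
    and "numerical_solution G \<epsilon> \<eta> dt U"
    and "\<zeta> > 1 / \<epsilon> + \<eta> - 1"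
    and "M = max (sqrt (max 0 \<zeta>)) (sup_bound G C \<epsilon> \<eta> \<zeta> (U 0))"
    and "3 * M\<^sup>2 \<le> \<bar>1 - \<eta>\<bar> \<or>
         3 * M\<^sup>2 > \<bar>1 - \<eta>\<bar> \<and> dt \<le> 2 / (3 * M\<^sup>2 - \<bar>1 - \<eta>\<bar>)"
  shows "decseq (\<lambda>n. energy G \<epsilon> \<eta> (U n)) \<and>
         (\<forall>n. norm_Linf G (U n) \<le> sup_bound G C \<epsilon> \<eta> \<zeta> (U 0))"
proof -
  note G = assms(1) and C = assms(2) and par = assms(3,6)
  let ?b = "sup_bound G C \<epsilon> \<eta> \<zeta> (U 0)"
  \<comment> \<open>The two entries of the maximum have separate roles: the first yields
    \<open>\<zeta> \<le> M\<^sup>2\<close>, so that the truncated potential keeps its lower bound;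
    the second places states satisfying the sup bound inside \<open>[-M, M]\<close>.\<close>
  have "M \<ge> sqrt (max 0 \<zeta>)" and bM: "?b \<le> M" using assms(7) by simp_all
  then have "M \<ge> 0" and "max 0 \<zeta> \<le> M\<^sup>2"
    using real_sqrt_ge_zero[of "max 0 \<zeta>"] by (simp_all only: sqrt_le_D) linarith
  then have lower: "\<zeta> / 2 * u\<^sup>2 - \<zeta>\<^sup>2 / 4 \<le> trunc_pot M u" for u
    by (intro trunc_pot_lower) simp_all
  have grid: "\<bar>U n i j k\<bar> \<le> M" if "norm_Linf G (U n) \<le> ?b" "i \<le> nx G" "j \<le> ny G" "k \<le> nz G"
    for n i j k
    using abs_le_norm_Linf[OF that(2-), of "U n"] that(1) bM by linarith
  have step: "norm_Linf G (U (Suc n)) \<le> ?b" "energy G \<epsilon> \<eta> (U (Suc n)) \<le> energy G \<epsilon> \<eta> (U n)"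
    if bd: "norm_Linf G (U n) \<le> ?b" and le: "energy G \<epsilon> \<eta> (U n) \<le> energy G \<epsilon> \<eta> (U 0)" for n
  proof -
    have dec: "energy_pot G (trunc_pot M) \<epsilon> \<eta> (U (Suc n)) \<le> energy G \<epsilon> \<eta> (U n)"
      by (rule energy_pot_step[OF G assms(3-5,8) grid[OF bd]])
    show *: "norm_Linf G (U (Suc n)) \<le> ?b"
      using dec le by (intro norm_Linf_le_sup_bound[OF G C par lower]) simp
    \<comment> \<open>The bound just shown puts \<open>U (Suc n)\<close> where the potentials agree,
      so the decrease transfers to the true energy.\<close>
    have "energy G \<epsilon> \<eta> (U (Suc n)) = energy_pot G (trunc_pot M) \<epsilon> \<eta> (U (Suc n))"
      unfolding energy_eq_energy_pot[OF G]
      by (rule energy_pot_cong[OF G]) (simp add: trunc_pot_def grid[OF *])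
    with dec show "energy G \<epsilon> \<eta> (U (Suc n)) \<le> energy G \<epsilon> \<eta> (U n)" by simp
  qed
  \<comment> \<open>The comparison with the initial energy is carried along because
    \<open>sup_bound\<close> is expressed through \<open>U 0\<close>. At \<open>n = 0\<close> the
    bound comes from coercivity of the quartic energy itself.\<close>
  have inv: "norm_Linf G (U n) \<le> ?b \<and> energy G \<epsilon> \<eta> (U n) \<le> energy G \<epsilon> \<eta> (U 0)" for n
  proof (induction n)
    case 0
    then show ?case
      by (simp add: norm_Linf_le_sup_bound[OF G C par quartic_lower] energy_eq_energy_pot[OF G])
  next
    case (Suc n)
    then show ?case using step[of n] by linarith
  qed
  then show ?thesis using step(2) by (simp add: decseq_Suc_iff)
qed

end
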